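(* Let $\mathbf{d}$ be a distance on a set $X$ and let $(x_\lambda)_{\lambda\in\Lambda}\subseteq X$ be a $\mathbf{d}$-Cauchy net. If $X$ is $\leq^{\mathbf{d}}$-$\mathbf{d}$-complete and $\mathbf{d}_{\mathbf{F}}\leq\mathbf{I}$ (i.e. $\mathbf{d}_{\mathbf{F}}(r)\leq r$ for all $r\in[0,\infty]$), then there is a $\mathbf{d}^\vee$-Cauchy sequence $(y_n)_{n\in\mathbb{N}}$ in $X$ with $$(x_\lambda)\mathbf{d}=(y_n)\mathbf{d}\qquad\text{and}\qquad\lim_{\lambda,n}\mathbf{d}(x_\lambda,y_n)=0,$$ that is, $\lim_\lambda\mathbf{d}(x_\lambda,z)=\lim_n\mathbf{d}(y_n,z)$ for all $z\in X$, and for every $\epsilon>0$ there are $\lambda_0\in\Lambda$ and $n_0\in\mathbb{N}$ such that $\mathbf{d}(x_\lambda,y_n)<\epsilon$ for all $\lambda\succ\lambda_0$ and $n>n_0$.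
   Context: A distance on $X$ is a function $\mathbf{d}:X\times X\to[0,\infty]$ with $\mathbf{d}(x,y)\leq\mathbf{d}(x,z)+\mathbf{d}(z,y)$ for all $x,y,z\in X$ (neither symmetry nor $\mathbf{d}(x,x)=0$ is required). In $[0,\infty]$, $\inf\emptyset=\infty$ and $\sup\emptyset=0$. $\mathbf{d}^\vee(x,y)=\max(\mathbf{d}(x,y),\mathbf{d}(y,x))$. A net is a family $(x_\lambda)_{\lambda\in\Lambda}$ indexed by a nonempty set $\Lambda$ with a transitive (possibly non-reflexive) relation $\prec$ such that for all $\gamma,\delta\in\Lambda$ there is $\lambda$ with $\gamma,\delta\prec\lambda$. Limits are taken with "eventually" meaning "for all $\lambda\succ\alpha$, for some $\alpha$". The net is $\mathbf{d}$-Cauchy if for every $\epsilon>0$ there is $\alpha$ such that $\mathbf{d}(x_\gamma,x_\delta)<\epsilon$ whenever $\alpha\prec\gamma\prec\delta$; likewise for $\mathbf{d}^\vee$ and for sequences (nets indexed by $(\mathbb{N},<)$). For a $\mathbf{d}$-Cauchy net, and hence for a $\mathbf{d}^\vee$-Cauchy sequence, the limits $\lim_\lambda\mathbf{d}(x_\lambda,z)$ exist in $[0,\infty]$ for all $z\in X$. $x\leq^{\mathbf{d}}y$ iff $\mathbf{d}(x,y)=0$; $Y\leq^{\mathbf{d}}x$ means $y\leq^{\mathbf{d}}x$ for all $y\in Y$. $x$ is a $\mathbf{d}$-supremum of $Y\subseteq X$ if $Y\leq^{\mathbf{d}}x$ and $\mathbf{d}(x,z)=\sup_{y\in Y}\mathbf{d}(y,z)$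 for all $z\in X$. $Y$ is $\leq^{\mathbf{d}}$-directed if every finite $F\subseteq Y$ has some $y\in Y$ with $F\leq^{\mathbf{d}}y$. $X$ is $\leq^{\mathbf{d}}$-$\mathbf{d}$-complete if every $\leq^{\mathbf{d}}$-directed $Y\subseteq X$ has a $\mathbf{d}$-supremum. With $x_\bullet^r=\{z\in X:\mathbf{d}(z,x)<r\}$, define $\mathbf{d}_{\mathbf{F}}:[0,\infty]\to[0,\infty]$ by $$\mathbf{d}_{\mathbf{F}}(r)=\sup_{x\in X}\ \sup_{F\subseteq x_\bullet^r,\ F\text{ finite}}\ \inf_{F\leq^{\mathbf{d}}y}\mathbf{d}(y,x).$$ $\mathbf{I}$ is the identity on $[0,\infty]$. *)

theory Defs
  imports "HOL-Library.Extended_Nonnegative_Real"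
begin

definition is_distance :: "'a set \<Rightarrow> ('a \<Rightarrow> 'a \<Rightarrow> ennreal) \<Rightarrow> bool" where
  "is_distance X d \<longleftrightarrow> (\<forall>x\<in>X. \<forall>y\<in>X. \<forall>z\<in>X. d x y \<le> d x z + d z y)"

definition dvee :: "('a \<Rightarrow> 'a \<Rightarrow> ennreal) \<Rightarrow> 'a \<Rightarrow> 'a \<Rightarrow> ennreal" where
  "dvee d x y = max (d x y) (d y x)"

text \<open>The relation on the index set is transitive but need not be reflexive, so nets indexed by
  the natural numbers with the strict order are included.\<close>

definition net_index :: "'l set \<Rightarrow> ('l \<Rightarrow> 'l \<Rightarrow> bool) \<Rightarrow> bool" where
  "net_index \<Lambda> prec \<longleftrightarrow> \<Lambda> \<noteq> {} \<and>
     (\<forall>a\<in>\<Lambda>. \<forall>b\<in>\<Lambda>. \<forall>c\<in>\<Lambda>. prec a b \<longrightarrow> prec b c \<longrightarrow> prec a c) \<and>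
     (\<forall>a\<in>\<Lambda>. \<forall>b\<in>\<Lambda>. \<exists>c\<in>\<Lambda>. prec a c \<and> prec b c)"

definition net_filter :: "'l set \<Rightarrow> ('l \<Rightarrow> 'l \<Rightarrow> bool) \<Rightarrow> 'l filter" where
  "net_filter \<Lambda> prec = (INF a\<in>\<Lambda>. principal {l\<in>\<Lambda>. prec a l})"

definition net_Cauchy ::
  "('a \<Rightarrow> 'a \<Rightarrow> ennreal) \<Rightarrow> 'l set \<Rightarrow> ('l \<Rightarrow> 'l \<Rightarrow> bool) \<Rightarrow> ('l \<Rightarrow> 'a) \<Rightarrow> bool" where
  "net_Cauchy d \<Lambda> prec x \<longleftrightarrow>
     (\<forall>\<epsilon>>0. \<exists>a\<in>\<Lambda>. \<forall>b\<in>\<Lambda>. \<forall>c\<in>\<Lambda>. prec a b \<longrightarrow> prec b c \<longrightarrow> d (x b) (x c) < \<epsilon>)"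

definition seq_Cauchy :: "('a \<Rightarrow> 'a \<Rightarrow> ennreal) \<Rightarrow> (nat \<Rightarrow> 'a) \<Rightarrow> bool" where
  "seq_Cauchy d y \<longleftrightarrow> net_Cauchy d UNIV (<) y"

definition dle :: "('a \<Rightarrow> 'a \<Rightarrow> ennreal) \<Rightarrow> 'a \<Rightarrow> 'a \<Rightarrow> bool" where
  "dle d x y \<longleftrightarrow> d x y = 0"

definition is_dsup :: "'a set \<Rightarrow> ('a \<Rightarrow> 'a \<Rightarrow> ennreal) \<Rightarrow> 'a set \<Rightarrow> 'a \<Rightarrow> bool" where
  "is_dsup X d Y x \<longleftrightarrow>
     x \<in> X \<and> (\<forall>y\<in>Y. dle d y x) \<and> (\<forall>z\<in>X. d x z = (SUP y\<in>Y. d y z))"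

text \<open>The finite set may be empty, so directed sets are nonempty.\<close>

definition dle_directed :: "('a \<Rightarrow> 'a \<Rightarrow> ennreal) \<Rightarrow> 'a set \<Rightarrow> bool" where
  "dle_directed d Y \<longleftrightarrow> (\<forall>F. finite F \<and> F \<subseteq> Y \<longrightarrow> (\<exists>y\<in>Y. \<forall>f\<in>F. dle d f y))"

definition dle_d_complete :: "'a set \<Rightarrow> ('a \<Rightarrow> 'a \<Rightarrow> ennreal) \<Rightarrow> bool" where
  "dle_d_complete X d \<longleftrightarrow> (\<forall>Y. Y \<subseteq> X \<and> dle_directed d Y \<longrightarrow> (\<exists>x. is_dsup X d Y x))"

definition lower_ball :: "'a set \<Rightarrow> ('a \<Rightarrow> 'a \<Rightarrow> ennreal) \<Rightarrow> 'a \<Rightarrow> ennreal \<Rightarrow> 'a set" where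
  "lower_ball X d x r = {z\<in>X. d z x < r}"

definition d_F :: "'a set \<Rightarrow> ('a \<Rightarrow> 'a \<Rightarrow> ennreal) \<Rightarrow> ennreal \<Rightarrow> ennreal" where
  "d_F X d r =
     (SUP x\<in>X. SUP F\<in>{F. finite F \<and> F \<subseteq> lower_ball X d x r}.
        INF y\<in>{y\<in>X. \<forall>f\<in>F. dle d f y}. d y x)"

lemma eventually_net_filter:
  assumes "net_index \<Lambda> prec"
  shows "eventually P (net_filter \<Lambda> prec) \<longleftrightarrow> (\<exists>a\<in>\<Lambda>. \<forall>l\<in>\<Lambda>. prec a l \<longrightarrow> P l)"
proof -
  have "eventually P (net_filter \<Lambda> prec) \<longleftrightarrow>
      (\<exists>a\<in>\<Lambda>. eventually P (principal {l\<in>\<Lambda>. prec a l}))"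
    unfolding net_filter_def
  proof (rule eventually_INF_base)
    show "\<Lambda> \<noteq> {}"
      using assms by (simp add: net_index_def)
  next
    fix a b assume ab: "a \<in> \<Lambda>" "b \<in> \<Lambda>"
    then obtain c where c: "c \<in> \<Lambda>" "prec a c" "prec b c"
      using assms unfolding net_index_def by blast
    have "{l\<in>\<Lambda>. prec c l} \<subseteq> {l\<in>\<Lambda>. prec a l} \<inter> {l\<in>\<Lambda>. prec b l}"
      using assms ab c unfolding net_index_def by blast
    then show "\<exists>c\<in>\<Lambda>. principal {l\<in>\<Lambda>. prec c l} \<le>
        inf (principal {l\<in>\<Lambda>. prec a l}) (principal {l\<in>\<Lambda>. prec b l})"
      using c(1) by auto
  qed
  then show ?thesis
    by (auto simp: eventually_principal)
qed

lemma net_index_nat: "net_index (UNIV :: nat set) (<)"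
  unfolding net_index_def by (auto intro: gt_ex less_trans) (metis less_Suc_eq_le max.cobounded1 max.cobounded2)

lemma net_filter_nat: "net_filter (UNIV :: nat set) (<) = sequentially"
  by (rule filter_eqI)
    (simp add: eventually_net_filter[OF net_index_nat] eventually_at_top_dense)

end

theory Submission
  imports Defs
begin

text \<open>For \<open>e > 0\<close> let \<open>Y\<^sub>e\<close> be the set of points \<open>y\<close> with \<open>limsup d(y, x\<^sub>\<lambda>) < e\<close>.
  The hypothesis on \<open>d_F\<close> makes \<open>Y\<^sub>e\<close> directed, and it eventually contains \<open>x\<^sub>\<lambda>\<close>
  because the net is Cauchy. A supremum \<open>s\<^sub>e\<close> of \<open>Y\<^sub>e\<close> therefore satisfies
  \<open>limsup d(x\<^sub>\<lambda>, z) \<le> d(s\<^sub>e, z) \<le> e + liminf d(x\<^sub>\<lambda>, z)\<close> for all \<open>z\<close>, and \<open>d(x\<^sub>\<lambda>, s\<^sub>e) = 0\<close>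
  eventually. Any choice of \<open>s\<^sub>e\<close> along a sequence \<open>e \<rightarrow> 0\<close> is the required sequence.\<close>

text \<open>The witness \<open>r\<close> strictly below \<open>e\<close>, instead of an eventual
  bound by \<open>e\<close> itself, leaves the slack that directedness spends.\<close>

definition lower_approximants ::
  "'a set \<Rightarrow> ('a \<Rightarrow> 'a \<Rightarrow> ennreal) \<Rightarrow> 'l filter \<Rightarrow> ('l \<Rightarrow> 'a) \<Rightarrow> ennreal \<Rightarrow> 'a set" where
  "lower_approximants X d F x e = {y\<in>X. \<exists>r<e. \<forall>\<^sub>F l in F. d y (x l) < r}"

lemma is_distanceD:
  "is_distance X d \<Longrightarrow> a \<in> X \<Longrightarrow> b \<in> X \<Longrightarrow> c \<in> X \<Longrightarrow> d a c \<le> d a b + d b c"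
  unfolding is_distance_def by blast

text \<open>Two allowances are cut from the gap below \<open>e\<close>: \<open>s\<close> for an
  infimum that may not be attained, \<open>t\<close> for one Cauchy step.\<close>

lemma ennreal_less_split:
  fixes r e :: ennreal
  assumes "r < e"
  obtains s t where "r < s" "0 < t" "s + t < e"
proof -
  obtain s u where su: "r < s" "s < u" "u < e"
    using assms dense by meson
  show thesis
  proof (rule that)
    show "0 < u - s"
      using su by (simp add: diff_gr0_ennreal)
    show "s + (u - s) < e"
      using su by (simp add: add_diff_inverse_ennreal less_imp_le)
  qed (use su in simp)
qed

lemma d_F_upper_bound:
  assumes "d_F X d r \<le> r" "r < s" "x \<in> X" "finite A" "A \<subseteq> lower_ball X d x r"
  obtains y where "y \<in> X" "\<forall>a\<in>A. dle d a y" "d y x < s"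
proof -
  have "(INF y\<in>{y\<in>X. \<forall>a\<in>A. dle d a y}. d y x) \<le> d_F X d r"
    unfolding d_F_def using assms(3-5) by (intro SUP_upper2[OF assms(3)] SUP_upper) auto
  also have "\<dots> < s"
    using assms(1,2) by (rule le_less_trans)
  finally show thesis
    using that by (auto simp: INF_less_iff)
qed

text \<open>Far enough out, a single \<open>x l\<close> has all of \<open>A\<close> in its lower
  ball of radius \<open>r\<close>. The bound on \<open>d_F\<close> gives an upper bound of
  \<open>A\<close> within \<open>s\<close> of this \<open>x l\<close>, and the Cauchy condition
  carries it to the tail at cost \<open>t\<close>.\<close>

lemma lower_approximants_directed:
  assumes dist: "is_distance X d" and nontriv: "F \<noteq> bot"
    and X: "\<forall>\<^sub>F l in F. x l \<in> X"
    and Cauchy: "\<And>e. e > 0 \<Longrightarrow> \<forall>\<^sub>F b in F. \<forall>\<^sub>F c in F. d (x b) (x c) < e"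
    and dF: "\<And>r. d_F X d r \<le> r" and e: "0 < e"
  shows "dle_directed d (lower_approximants X d F x e)"
  unfolding dle_directed_def
proof (intro allI impI, elim conjE)
  fix A assume fin: "finite A" and A: "A \<subseteq> lower_approximants X d F x e"
  then have "\<forall>a\<in>A. \<exists>r<e. \<forall>\<^sub>F l in F. d a (x l) < r"
    by (auto simp: lower_approximants_def)
  then obtain \<rho> where \<rho>: "\<And>a. a \<in> A \<Longrightarrow> \<rho> a < e"
      "\<And>a. a \<in> A \<Longrightarrow> \<forall>\<^sub>F l in F. d a (x l) < \<rho> a"
    by metis
  \<comment> \<open>Inserting 0 covers empty \<open>A\<close>; \<open>r < e\<close> then rests on
    \<open>0 < e\<close>.\<close>
  define r where "r = Max (insert 0 (\<rho> ` A))"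
  have "r < e"
    unfolding r_def using fin e \<rho>(1) by (subst Max_less_iff) auto
  then obtain s t where st: "r < s" "0 < t" "s + t < e"
    by (rule ennreal_less_split)
  have \<rho>_le: "\<rho> a \<le> r" if "a \<in> A" for a
    unfolding r_def using fin that by (intro Max_ge) auto
  have "\<forall>\<^sub>F l in F. \<forall>a\<in>A. d a (x l) < r"
    using fin eventually_mono[OF \<rho>(2) less_le_trans[OF _ \<rho>_le]]
    by (intro eventually_ball_finite) auto
  with X Cauchy[OF st(2)]
  have "\<forall>\<^sub>F l in F. x l \<in> X \<and> (\<forall>a\<in>A. d a (x l) < r) \<and> (\<forall>\<^sub>F c in F. d (x l) (x c) < t)"
    by eventually_elim auto
  then obtain l where l: "x l \<in> X" "\<forall>a\<in>A. d a (x l) < r" "\<forall>\<^sub>F c in F. d (x l) (x c) < t"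
    using eventually_happens'[OF nontriv] by blast
  have "A \<subseteq> lower_ball X d (x l) r"
    using A l(2) by (auto simp: lower_approximants_def lower_ball_def)
  from d_F_upper_bound[OF dF st(1) l(1) fin this]
  obtain y where y: "y \<in> X" "\<forall>a\<in>A. dle d a y" "d y (x l) < s" .
  have "\<forall>\<^sub>F c in F. d y (x c) < s + t"
    using l(3) X
  proof eventually_elim
    case (elim c)
    have "d y (x c) \<le> d y (x l) + d (x l) (x c)"
      using dist y(1) l(1) elim(2) by (rule is_distanceD)
    also have "\<dots> < s + t"
      using y(3) elim(1) by (rule add_strict_mono)
    finally show ?case .
  qed
  then have "y \<in> lower_approximants X d F x e"
    using y(1) st(3) by (auto simp: lower_approximants_def)
  then show "\<exists>y\<in>lower_approximants X d F x e. \<forall>a\<in>A. dle d a y"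
    using y(2) by blast
qed

lemma eventually_in_lower_approximants:
  assumes X: "\<forall>\<^sub>F l in F. x l \<in> X"
    and Cauchy: "\<And>e. e > 0 \<Longrightarrow> \<forall>\<^sub>F b in F. \<forall>\<^sub>F c in F. d (x b) (x c) < e" and e: "0 < e"
  shows "\<forall>\<^sub>F l in F. x l \<in> lower_approximants X d F x e"
proof -
  obtain r where r: "0 < r" "r < e"
    using dense[OF e] by blast
  show ?thesis
    using X Cauchy[OF r(1)]
    by eventually_elim (use r(2) in \<open>auto simp: lower_approximants_def\<close>)
qed

lemma dsup_lower_approximants_le:
  assumes dist: "is_distance X d"
    and X: "\<forall>\<^sub>F l in F. x l \<in> X"
    and sup: "is_dsup X d (lower_approximants X d F x (ennreal e)) s" and z: "z \<in> X"
  shows "d s z \<le> ennreal e + Liminf F (\<lambda>l. d (x l) z)"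
proof -
  have "d y z \<le> ennreal e + Liminf F (\<lambda>l. d (x l) z)"
    if "y \<in> lower_approximants X d F x (ennreal e)" for y
  proof -
    obtain r where r: "y \<in> X" "r < ennreal e" "\<forall>\<^sub>F l in F. d y (x l) < r"
      using \<open>y \<in> _\<close> by (auto simp: lower_approximants_def)
    \<comment> \<open>With the constant on the left, \<open>Liminf_bounded\<close> applies; as
      \<open>ennreal e\<close> is finite, the subtraction can be undone even at infinite
      distances.\<close>
    have "\<forall>\<^sub>F l in F. d y z - ennreal e \<le> d (x l) z"
      using r(3) X
    proof eventually_elim
      case (elim l)
      have "d y z \<le> d y (x l) + d (x l) z"
        using dist r(1) elim(2) z by (rule is_distanceD)
      also have "\<dots> \<le> ennreal e + d (x l) z"
        using r(2) elim(1) by (intro add_right_mono) simp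
      finally show ?case
        by (simp add: ennreal_minus_le_iff)
    qed
    then have "d y z - ennreal e \<le> Liminf F (\<lambda>l. d (x l) z)"
      by (rule Liminf_bounded)
    then show ?thesis
      by (simp add: ennreal_minus_le_iff)
  qed
  then show ?thesis
    using sup z unfolding is_dsup_def by (auto intro: SUP_least)
qed

text \<open>Only tails of the net matter, so a proper filter with an iterated "eventually" replaces
  the index relation. In the last conclusion the tail does not depend on \<open>n\<close>.\<close>

lemma Cauchy_filter_equivalent_sequence:
  assumes dist: "is_distance X d" and nontriv: "F \<noteq> bot"
    and X: "\<forall>\<^sub>F l in F. x l \<in> X"
    and Cauchy: "\<And>e. e > 0 \<Longrightarrow> \<forall>\<^sub>F b in F. \<forall>\<^sub>F c in F. d (x b) (x c) < e"
    and complete: "dle_d_complete X d" and dF: "\<And>r. d_F X d r \<le> r"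
  obtains y :: "nat \<Rightarrow> 'a" where
    "range y \<subseteq> X" "seq_Cauchy (dvee d) y"
    "\<And>z. z \<in> X \<Longrightarrow> \<exists>L. ((\<lambda>l. d (x l) z) \<longlongrightarrow> L) F \<and> (\<lambda>n. d (y n) z) \<longlonglongrightarrow> L"
    "\<And>e. e > 0 \<Longrightarrow> \<forall>\<^sub>F l in F. \<forall>n. d (x l) (y n) < e"
proof -
  define \<epsilon> where "\<epsilon> n = inverse (real (Suc n))" for n
  have \<epsilon>_pos: "0 < ennreal (\<epsilon> n)" for n
    by (simp add: \<epsilon>_def)
  have \<epsilon>_lim: "(\<lambda>n. ennreal (\<epsilon> n)) \<longlonglongrightarrow> 0"
    unfolding \<epsilon>_def using LIMSEQ_inverse_real_of_nat tendsto_ennrealI by fastforce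
  let ?Y = "\<lambda>n. lower_approximants X d F x (ennreal (\<epsilon> n))"
  have "\<exists>s. is_dsup X d (?Y n) s" for n
    using complete lower_approximants_directed[OF dist nontriv X Cauchy dF \<epsilon>_pos]
    by (auto simp: dle_d_complete_def lower_approximants_def)
  then obtain y where y: "\<And>n. is_dsup X d (?Y n) (y n)"
    by metis
  have yX: "y n \<in> X" for n
    using y by (auto simp: is_dsup_def)
  have in_Y: "\<forall>\<^sub>F l in F. x l \<in> ?Y n" for n
    using X Cauchy \<epsilon>_pos by (rule eventually_in_lower_approximants)
  have le_y: "\<forall>\<^sub>F l in F. d (x l) (y n) = 0" for n
    using in_Y[of n] by eventually_elim (use y in \<open>auto simp: is_dsup_def dle_def\<close>)
  let ?I = "\<lambda>z. Liminf F (\<lambda>l. d (x l) z)" and ?S = "\<lambda>z. Limsup F (\<lambda>l. d (x l) z)"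
  have upper: "d (y n) z \<le> ennreal (\<epsilon> n) + ?I z" if "z \<in> X" for n z
    using dist X y that by (rule dsup_lower_approximants_le)
  have lower: "?S z \<le> d (y n) z" if z: "z \<in> X" for n z
  proof (rule Limsup_bounded)
    show "\<forall>\<^sub>F l in F. d (x l) z \<le> d (y n) z"
      using in_Y[of n]
      by eventually_elim (use y z in \<open>auto simp: is_dsup_def intro: SUP_upper\<close>)
  qed
  have bound_lim: "(\<lambda>n. ennreal (\<epsilon> n) + ?I z) \<longlonglongrightarrow> ?I z" for z
    using tendsto_add[OF \<epsilon>_lim tendsto_const[of "?I z"]] by simp
  show thesis
  proof (rule that)
    show "range y \<subseteq> X"
      using yX by auto
    \<comment> \<open>Take \<open>z = y m\<close> in \<open>upper\<close>: the lower limit vanishes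
      by \<open>le_y\<close>. No order between \<open>n\<close> and \<open>m\<close> is involved, so
      both directions of \<open>dvee\<close> are controlled.\<close>
    have y_le: "d (y n) (y m) \<le> ennreal (\<epsilon> n)" for n m
    proof -
      have "?I (y m) \<le> 0"
        using Liminf_le_Limsup[OF nontriv] Limsup_bounded[OF eventually_mono[OF le_y[of m]]]
        by (metis order.trans order_refl)
      then show ?thesis
        using upper[OF yX, of n m] by simp
    qed
    show "seq_Cauchy (dvee d) y"
      unfolding seq_Cauchy_def net_Cauchy_def
    proof (intro allI impI)
      fix e :: ennreal assume "0 < e"
      then have "\<forall>\<^sub>F n in sequentially. ennreal (\<epsilon> n) < e"
        using \<epsilon>_lim by (rule order_tendstoD(2)[rotated])
      then obtain N where N: "\<And>n. n \<ge> N \<Longrightarrow> ennreal (\<epsilon> n) < e"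
        by (auto simp: eventually_sequentially)
      then have "dvee d (y b) (y c) < e" if "N < b" "b < c" for b c
        using that y_le[of b c] y_le[of c b] unfolding dvee_def
        by (meson le_less_trans less_imp_le less_trans max_less_iff_conj)
      then show "\<exists>a\<in>UNIV. \<forall>b\<in>UNIV. \<forall>c\<in>UNIV. a < b \<longrightarrow> b < c \<longrightarrow> dvee d (y b) (y c) < e"
        by blast
    qed
  next
    fix z assume z: "z \<in> X"
    \<comment> \<open>Letting n tend to infinity in \<open>?S z \<le> \<epsilon> n + ?I z\<close>
      proves that the limit along \<open>F\<close> exists.\<close>
    have "?S z \<le> ?I z"
      using order.trans[OF lower upper, OF z z]
      by (intro tendsto_lowerbound[OF bound_lim]) auto
    then have eq: "?S z = ?I z"
      using Liminf_le_Limsup[OF nontriv] by (rule antisym)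
    have "((\<lambda>l. d (x l) z) \<longlongrightarrow> ?I z) F"
      using nontriv refl eq by (rule Liminf_eq_Limsup)
    moreover have "(\<lambda>n. d (y n) z) \<longlonglongrightarrow> ?I z"
      using lower[OF z] upper[OF z] eq
      by (intro tendsto_sandwich[OF _ _ tendsto_const bound_lim]) auto
    ultimately show "\<exists>L. ((\<lambda>l. d (x l) z) \<longlongrightarrow> L) F \<and> (\<lambda>n. d (y n) z) \<longlonglongrightarrow> L"
      by blast
  next
    fix e :: ennreal assume "0 < e"
    from Cauchy[OF this] X show "\<forall>\<^sub>F l in F. \<forall>n. d (x l) (y n) < e"
    proof eventually_elim
      case (elim l)
      show ?case
      proof
        fix n
        \<comment> \<open>The claim does not mention \<open>c\<close>: it is an intermediate point
          near \<open>x l\<close> with \<open>d (x c) (y n) = 0\<close>, and properness of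
          \<open>F\<close> discards it. It may depend on \<open>n\<close>, while \<open>l\<close>
          does not.\<close>
        have "\<forall>\<^sub>F c in F. d (x l) (y n) < e"
          using elim(1) X le_y[of n]
        proof eventually_elim
          case (elim c)
          have "d (x l) (y n) \<le> d (x l) (x c) + d (x c) (y n)"
            using dist \<open>x l \<in> X\<close> elim(2) yX by (rule is_distanceD)
          then show ?case
            using elim(1,3) by simp
        qed
        then show "d (x l) (y n) < e"
          using nontriv by simp
      qed
    qed
  qed
qed

theorem theorem2:
  fixes X :: "'a set" and d :: "'a \<Rightarrow> 'a \<Rightarrow> ennreal"
    and \<Lambda> :: "'l set" and prec :: "'l \<Rightarrow> 'l \<Rightarrow> bool" and x :: "'l \<Rightarrow> 'a"
  assumes "is_distance X d"
    and "net_index \<Lambda> prec"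
    and "\<And>l. l \<in> \<Lambda> \<Longrightarrow> x l \<in> X"
    and "net_Cauchy d \<Lambda> prec x"
    and "dle_d_complete X d"
    and "\<And>r. d_F X d r \<le> r"
  shows "\<exists>y :: nat \<Rightarrow> 'a. range y \<subseteq> X \<and> seq_Cauchy (dvee d) y \<and>
    (\<forall>z\<in>X. \<exists>L. ((\<lambda>l. d (x l) z) \<longlongrightarrow> L) (net_filter \<Lambda> prec) \<and>
                 (\<lambda>n. d (y n) z) \<longlonglongrightarrow> L) \<and>
    (\<forall>\<epsilon>>0. \<exists>l0\<in>\<Lambda>. \<exists>n0. \<forall>l\<in>\<Lambda>. \<forall>n. prec l0 l \<longrightarrow> n > n0 \<longrightarrow> d (x l) (y n) < \<epsilon>)"
proof -
  let ?F = "net_filter \<Lambda> prec"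
  note ev = eventually_net_filter[OF assms(2)]
  \<comment> \<open>Directedness applied to the pair (a, a) makes every tail nonempty, even for an
    irreflexive relation.\<close>
  have "?F \<noteq> bot"
    using assms(2) unfolding net_index_def trivial_limit_def ev by blast
  moreover have "\<forall>\<^sub>F l in ?F. x l \<in> X"
    using assms(2,3) unfolding net_index_def ev by blast
  \<comment> \<open>The threshold for the inner "eventually" is \<open>b\<close> itself.\<close>
  moreover have "\<forall>\<^sub>F b in ?F. \<forall>\<^sub>F c in ?F. d (x b) (x c) < e" if "e > 0" for e
    using assms(4) that unfolding net_Cauchy_def ev by blast
  ultimately obtain y :: "nat \<Rightarrow> 'a" where y:
    "range y \<subseteq> X" "seq_Cauchy (dvee d) y"
    "\<And>z. z \<in> X \<Longrightarrow> \<exists>L. ((\<lambda>l. d (x l) z) \<longlongrightarrow> L) ?F \<and> (\<lambda>n. d (y n) z) \<longlonglongrightarrow> L"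
    "\<And>e. e > 0 \<Longrightarrow> \<forall>\<^sub>F l in ?F. \<forall>n. d (x l) (y n) < e"
    using Cauchy_filter_equivalent_sequence[OF assms(1) _ _ _ assms(5,6)] by blast
  have "\<exists>l0\<in>\<Lambda>. \<exists>n0. \<forall>l\<in>\<Lambda>. \<forall>n. prec l0 l \<longrightarrow> n > n0 \<longrightarrow> d (x l) (y n) < e" if "e > 0" for e
    using y(4)[OF that] unfolding ev by blast
  with y(1-3) show ?thesis
    by blast
qed

end
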